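(* Let $X,Y$ be compact metric spaces and let $\omega$ be a Radon measure on $X$. Let $N\ge 2$, let $p_1,\dots,p_N$ be distinct points in $Y$, and let $g_1,\dots,g_N$ be positive numbers. Let $\mathcal F\subset C^+(X)$ and $\mathcal T:\mathcal F\to C_s(X,Y)$ be such that $\mathcal F$ is $\mathcal T$-concave and property (A3) (defined in the context) holds, with functions $h_{t,y_0}$, $y_0\in Y$, $\alpha_{y_0}<t<\beta_{y_0}$. Assume that $$\omega(X)=\sum_{i=1}^N g_i,$$ and that there exist $b_i^0\in(\alpha_{p_i},\beta_{p_i})$, $1\le i\le N$, such that the function $\rho_0=\min_{1\le i\le N}h_{b_i^0,p_i}$ satisfies $M_{\mathcal T(\rho_0)}(\{p_i\})\le g_i$ for $2\le i\le N$. Then there exist $b_i\in(\alpha_{p_i},\beta_{p_i})$, $2\le i\le N$, such that, with $b_1=b_1^0$, the function $$\rho(x)=\min_{1\le i\le N}h_{b_i,p_i}(x)$$ satisfies $$M_{\mathcal T(\rho)}=\sum_{i=1}^N g_i\,\delta_{p_i}.$$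
   Context: Let $X,Y$ be compact metric spaces and $\omega$ a Radon measure on $X$ (nonnegative, finite, completed). A set-valued map $\Phi$ from $X$ to $Y$ assigns to each $x\in X$ a nonempty subset $\Phi(x)\subset Y$. $Y^X$ denotes the class of set-valued maps $\Phi$ from $X$ to $Y$ such that $\Phi(x)$ is a singleton for $\omega$-a.e. $x$. A map $\Phi\in Y^X$ is continuous at $x_0\in X$ if, whenever $x_k\to x_0$ and $y_k\in\Phi(x_k)$, there are a subsequence $y_{k_j}$ and $y_0\in\Phi(x_0)$ with $y_{k_j}\to y_0$. $C(X,Y)$ is the class of $\Phi\in Y^X$ continuous at every point of $X$, and $C_s(X,Y)$ is the class of $\Phi\in C(X,Y)$ with $\Phi(X)=\bigcup_{x\in X}\Phi(x)=Y$. For $\Phi\in C_s(X,Y)$ and $E\subset Y$, $\Phi^{-1}(E)=\{x\in X:\Phi(x)\cap E\ne\emptyset\}$, and $M_\Phi(E)=\omega(\Phi^{-1}(E))$, which is a Radon measure on $Y$. $C(X)$ is the set of real continuous functions on $X$ with the topology of uniform convergence; $C^+(X)$ is the set of continuous positive functions on $X$. A map $\mathcal T:\mathcal F\to C_s(X,Y)$, $\mathcal F\subset C(X)$, is continuous at $\phi\in\mathcal F$ if whenever $\phi_j\in\mathcal F$, $\phi_j\to\phi$ uniformly in $X$, $x_0\in X$ and $y_j\in\mathcal T(\phi_j)(x_0)$, there is a subsequence $y_{j_\ell}$ converging to some $y_0\in\mathcal T(\phi)(x_0)$. A class $\mathcal F\subset C^+(X)$ is $\mathcal T$-concave if: (A1)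 $f_1,f_2\in\mathcal F$ implies $f_1\wedge f_2=\min\{f_1,f_2\}\in\mathcal F$; and $\mathcal T:\mathcal F\to C_s(X,Y)$ is a map that is continuous at each $\phi\in\mathcal F$ and satisfies (A2): if $\phi_1,\phi_2\in\mathcal F$ and $\phi_1(x_0)\le\phi_2(x_0)$, then $\mathcal T(\phi_1)(x_0)\subset\mathcal T(\phi_1\wedge\phi_2)(x_0)$. Property (A3): for each $y_0\in Y$ there exist an interval $(\alpha_{y_0},\beta_{y_0})$ (endpoints possibly infinite) and a family $\{h_{t,y_0}\}_{\alpha_{y_0}<t<\beta_{y_0}}\subset\mathcal F$ such that (a) $y_0\in\mathcal T(h_{t,y_0})(x)$ for all $x\in X$; (b) $h_{t,y_0}\le h_{s,y_0}$ for $t\le s$; (c) $h_{t,y_0}\to 0$ uniformly as $t\to\alpha_{y_0}$; (d) $\max_{x\in X}|h_{t',y_0}(x)-h_{t,y_0}(x)|\to 0$ as $t'\to t$, for $\alpha_{y_0}<t<\beta_{y_0}$. *)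

theory Defs
  imports "HOL-Probability.Giry_Monad"
begin

text \<open>
  The compact metric spaces \<open>X\<close> and \<open>Y\<close> are the universes of two types \<open>'x\<close> and \<open>'y\<close> of class
  \<^class>\<open>metric_space\<close>; their compactness is an explicit hypothesis of the theorem.  Functions on
  \<open>X\<close> are then total functions, and equality of functions is equality on \<open>X\<close>.
\<close>

definition radon_measure :: "'x::metric_space measure \<Rightarrow> bool" where
  "radon_measure \<omega> \<longleftrightarrow>
     (\<exists>\<mu>. sets \<mu> = sets borel \<and> finite_measure \<mu> \<and>
        (\<forall>A\<in>sets borel. emeasure \<mu> A = (SUP K\<in>{K. K \<subseteq> A \<and> compact K}. emeasure \<mu> K)) \<and>
        \<omega> = completion \<mu>)"

text \<open>The class \<open>Y\<^sup>X\<close>.\<close>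

definition set_maps :: "'x measure \<Rightarrow> ('x \<Rightarrow> 'y set) set" where
  "set_maps \<omega> = {\<Phi>. (\<forall>x. \<Phi> x \<noteq> {}) \<and> (AE x in \<omega>. is_singleton (\<Phi> x))}"

definition svm_continuous_at ::
  "('x::metric_space \<Rightarrow> 'y::metric_space set) \<Rightarrow> 'x \<Rightarrow> bool" where
  "svm_continuous_at \<Phi> x0 \<longleftrightarrow>
     (\<forall>x y. x \<longlonglongrightarrow> x0 \<and> (\<forall>k::nat. y k \<in> \<Phi> (x k)) \<longrightarrow>
        (\<exists>r y0. strict_mono r \<and> y0 \<in> \<Phi> x0 \<and> (y \<circ> r) \<longlonglongrightarrow> y0))"

definition cont_maps :: "'x::metric_space measure \<Rightarrow> ('x \<Rightarrow> 'y::metric_space set) set" where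
  "cont_maps \<omega> = {\<Phi> \<in> set_maps \<omega>. \<forall>x0. svm_continuous_at \<Phi> x0}"

definition cont_surj_maps :: "'x::metric_space measure \<Rightarrow> ('x \<Rightarrow> 'y::metric_space set) set" where
  "cont_surj_maps \<omega> = {\<Phi> \<in> cont_maps \<omega>. (\<Union>x. \<Phi> x) = UNIV}"

definition svm_preimage :: "('x \<Rightarrow> 'y set) \<Rightarrow> 'y set \<Rightarrow> 'x set" where
  "svm_preimage \<Phi> E = {x. \<Phi> x \<inter> E \<noteq> {}}"

text \<open>
  \<^const>\<open>measure_of\<close> yields the zero measure when the set function it is given is not countably
  additive.  This does not happen for \<open>\<Phi>\<close> in \<open>C(X,Y)\<close>; see \<open>emeasure_M_measure\<close> below.
\<close>

definition M_measure ::
  "'x::metric_space measure \<Rightarrow> ('x \<Rightarrow> 'y::metric_space set) \<Rightarrow> 'y measure" where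
  "M_measure \<omega> \<Phi> =
     measure_of UNIV (sets borel) (\<lambda>E. emeasure \<omega> (svm_preimage \<Phi> E))"

text \<open>The Borel measure \<open>\<Sum>i\<in>I. g i \<delta>\<^bsub>p i\<^esub>\<close>, where \<open>\<delta>\<^bsub>q\<^esub>\<close> is \<open>return borel q\<close>.\<close>

definition weighted_diracs ::
  "'i set \<Rightarrow> ('i \<Rightarrow> real) \<Rightarrow> ('i \<Rightarrow> 'y::metric_space) \<Rightarrow> 'y measure" where
  "weighted_diracs I g p =
     measure_of UNIV (sets borel)
       (\<lambda>E. \<Sum>i\<in>I. ennreal (g i) * emeasure (return borel (p i)) E)"

definition pos_cont :: "('x::metric_space \<Rightarrow> real) set" where
  "pos_cont = {f. continuous_on UNIV f \<and> (\<forall>x. f x > 0)}"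

definition T_continuous_at ::
  "('x::metric_space \<Rightarrow> real) set \<Rightarrow> (('x \<Rightarrow> real) \<Rightarrow> 'x \<Rightarrow> 'y::metric_space set) \<Rightarrow>
   ('x \<Rightarrow> real) \<Rightarrow> bool" where
  "T_continuous_at F T \<phi> \<longleftrightarrow>
     (\<forall>\<phi>s x0 y. (\<forall>j::nat. \<phi>s j \<in> F) \<and> uniform_limit UNIV \<phi>s \<phi> sequentially \<and>
        (\<forall>j. y j \<in> T (\<phi>s j) x0) \<longrightarrow>
        (\<exists>r y0. strict_mono r \<and> y0 \<in> T \<phi> x0 \<and> (y \<circ> r) \<longlonglongrightarrow> y0))"

text \<open>The values of \<open>T\<close> outside \<open>F\<close> are irrelevant.\<close>

definition T_concave ::
  "'x::metric_space measure \<Rightarrow> ('x \<Rightarrow> real) set \<Rightarrow>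
   (('x \<Rightarrow> real) \<Rightarrow> 'x \<Rightarrow> 'y::metric_space set) \<Rightarrow> bool" where
  "T_concave \<omega> F T \<longleftrightarrow>
     F \<subseteq> pos_cont \<and>
     (\<forall>f1\<in>F. \<forall>f2\<in>F. (\<lambda>x. min (f1 x) (f2 x)) \<in> F) \<and>
     (\<forall>\<phi>\<in>F. T \<phi> \<in> cont_surj_maps \<omega>) \<and>
     (\<forall>\<phi>\<in>F. T_continuous_at F T \<phi>) \<and>
     (\<forall>\<phi>1\<in>F. \<forall>\<phi>2\<in>F. \<forall>x0. \<phi>1 x0 \<le> \<phi>2 x0 \<longrightarrow>
        T \<phi>1 x0 \<subseteq> T (\<lambda>x. min (\<phi>1 x) (\<phi>2 x)) x0)"

text \<open>
  Property (A3), for given endpoints \<open>\<alpha>\<close>, \<open>\<beta>\<close> and functions \<open>h\<close>; \<open>einterval a b\<close> is the set of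
  reals strictly between the extended reals \<open>a\<close> and \<open>b\<close>.  The filter
  \<open>filtercomap ereal (at_right (\<alpha> y0))\<close> describes real \<open>t\<close> tending to \<open>\<alpha> y0\<close> from the right, and is
  \<^const>\<open>at_bot\<close> when \<open>\<alpha> y0 = -\<infinity>\<close>.
\<close>

definition property_A3 ::
  "('x::metric_space \<Rightarrow> real) set \<Rightarrow> (('x \<Rightarrow> real) \<Rightarrow> 'x \<Rightarrow> 'y::metric_space set) \<Rightarrow>
   ('y \<Rightarrow> ereal) \<Rightarrow> ('y \<Rightarrow> ereal) \<Rightarrow> (real \<Rightarrow> 'y \<Rightarrow> 'x \<Rightarrow> real) \<Rightarrow> bool" where
  "property_A3 F T \<alpha> \<beta> h \<longleftrightarrow>
     (\<forall>y0. \<alpha> y0 < \<beta> y0 \<and>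
        (\<forall>t\<in>einterval (\<alpha> y0) (\<beta> y0). h t y0 \<in> F) \<and>
        (\<forall>t\<in>einterval (\<alpha> y0) (\<beta> y0). \<forall>x. y0 \<in> T (h t y0) x) \<and>
        (\<forall>t\<in>einterval (\<alpha> y0) (\<beta> y0). \<forall>s\<in>einterval (\<alpha> y0) (\<beta> y0).
           t \<le> s \<longrightarrow> (\<forall>x. h t y0 x \<le> h s y0 x)) \<and>
        uniform_limit UNIV (\<lambda>t. h t y0) (\<lambda>x. 0) (filtercomap ereal (at_right (\<alpha> y0))) \<and>
        (\<forall>t\<in>einterval (\<alpha> y0) (\<beta> y0).
           ((\<lambda>t'. SUP x. \<bar>h t' y0 x - h t y0 x\<bar>) \<longlongrightarrow> 0) (at t)))"


lemma sets_M_measure [simp]: "sets (M_measure \<omega> \<Phi>) = sets borel"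
  unfolding M_measure_def by (metis sets.sets_measure_of_eq space_borel)

lemma sets_weighted_diracs [simp]: "sets (weighted_diracs I g p) = sets borel"
  unfolding weighted_diracs_def by (metis sets.sets_measure_of_eq space_borel)

lemma closed_svm_preimage:
  assumes "\<Phi> \<in> cont_maps \<omega>" and "closed E"
  shows "closed (svm_preimage \<Phi> E)"
  unfolding closed_sequential_limits
proof (intro allI impI, elim conjE)
  fix x l assume x: "\<forall>n. x n \<in> svm_preimage \<Phi> E" and l: "x \<longlonglongrightarrow> l"
  from x have "\<forall>n. \<exists>y. y \<in> \<Phi> (x n) \<and> y \<in> E" by (auto simp: svm_preimage_def)
  then obtain y where y: "\<And>n. y n \<in> \<Phi> (x n)" "\<And>n. y n \<in> E" by metis
  have "svm_continuous_at \<Phi> l" using assms(1) by (simp add: cont_maps_def)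
  then obtain r y0 where r: "y0 \<in> \<Phi> l" "(y \<circ> r) \<longlonglongrightarrow> y0"
    unfolding svm_continuous_at_def using l y(1) by blast
  have "y0 \<in> E"
    using closed_sequentially[OF assms(2), of "y \<circ> r"] y(2) r(2) by simp
  with r show "l \<in> svm_preimage \<Phi> E" by (auto simp: svm_preimage_def)
qed

lemma
  assumes "radon_measure \<omega>"
  shows space_radon_measure: "space \<omega> = UNIV"
    and sets_radon_measure: "sets borel \<subseteq> sets \<omega>"
    and null_subset_radon_measure: "A \<in> null_sets \<omega> \<Longrightarrow> B \<subseteq> A \<Longrightarrow> B \<in> null_sets \<omega>"
proof -
  obtain \<mu> where \<mu>: "sets \<mu> = sets borel" "\<omega> = completion \<mu>"
    using assms unfolding radon_measure_def by blast
  show "space \<omega> = UNIV" using \<mu> sets_eq_imp_space_eq[OF \<mu>(1)] by simp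
  show "sets borel \<subseteq> sets \<omega>" using \<mu> by auto
  show "A \<in> null_sets \<omega> \<Longrightarrow> B \<subseteq> A \<Longrightarrow> B \<in> null_sets \<omega>"
    using \<mu> null_sets_completion_subset by blast
qed

lemma null_not_singleton:
  assumes "radon_measure \<omega>" and "\<Phi> \<in> set_maps \<omega>"
  shows "{x. \<not> is_singleton (\<Phi> x)} \<in> null_sets \<omega>"
proof -
  have "AE x in \<omega>. is_singleton (\<Phi> x)" using assms(2) by (simp add: set_maps_def)
  then obtain N where "{x \<in> space \<omega>. \<not> is_singleton (\<Phi> x)} \<subseteq> N" "N \<in> null_sets \<omega>"
    by (auto elim!: AE_E simp: null_sets_def)
  then show ?thesis
    using null_subset_radon_measure[OF assms(1)] space_radon_measure[OF assms(1)] by auto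
qed

lemma sets_svm_preimage:
  fixes \<Phi> :: "'x::metric_space \<Rightarrow> 'y::metric_space set"
  assumes \<omega>: "radon_measure \<omega>" and \<Phi>: "\<Phi> \<in> cont_maps \<omega>" and E: "E \<in> sets borel"
  shows "svm_preimage \<Phi> E \<in> sets \<omega>"
proof -
  have \<Phi>': "\<Phi> \<in> set_maps \<omega>" using \<Phi> by (simp add: cont_maps_def)
  define S where "S = {x. \<not> is_singleton (\<Phi> x)}"
  have S: "S \<in> null_sets \<omega>" unfolding S_def by (rule null_not_singleton[OF \<omega> \<Phi>'])
  have "E \<in> sigma_sets UNIV (Collect closed)"
    using E by (simp add: borel_eq_closed)
  then show ?thesis
  proof induction
    case (Basic a)
    then have "closed (svm_preimage \<Phi> a)" using closed_svm_preimage[OF \<Phi>] by simp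
    then show ?case using sets_radon_measure[OF \<omega>] by auto
  next
    case Empty
    then show ?case by (simp add: svm_preimage_def)
  next
    case (Compl a)
    define A where "A = svm_preimage \<Phi> a"
    have ne: "\<Phi> x \<noteq> {}" for x using \<Phi>' by (simp add: set_maps_def)
    have eq: "svm_preimage \<Phi> (UNIV - a) = (space \<omega> - A) \<union> (svm_preimage \<Phi> (UNIV - a) \<inter> S)"
      (is "?L = ?R")
    proof (intro set_eqI)
      fix x
      show "x \<in> ?L \<longleftrightarrow> x \<in> ?R"
      proof (cases "x \<in> S")
        case True
        then show ?thesis using ne[of x]
          by (auto simp: A_def svm_preimage_def space_radon_measure[OF \<omega>])
      next
        case False
        then obtain y where "\<Phi> x = {y}" by (auto simp: S_def is_singleton_def)
        then show ?thesis using False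
          by (auto simp: A_def svm_preimage_def space_radon_measure[OF \<omega>])
      qed
    qed
    have "svm_preimage \<Phi> (UNIV - a) \<inter> S \<in> null_sets \<omega>"
      using null_subset_radon_measure[OF \<omega> S] by auto
    then show ?case
      using Compl eq A_def by (metis null_setsD2 sets.Un sets.compl_sets)
  next
    case (Union a)
    have "svm_preimage \<Phi> (\<Union>i. a i) = (\<Union>i. svm_preimage \<Phi> (a i))"
      by (auto simp: svm_preimage_def)
    then show ?case using Union by auto
  qed
qed

lemma emeasure_M_measure:
  fixes \<Phi> :: "'x::metric_space \<Rightarrow> 'y::metric_space set"
  assumes \<omega>: "radon_measure \<omega>" and \<Phi>: "\<Phi> \<in> cont_maps \<omega>" and E: "E \<in> sets borel"
  shows "emeasure (M_measure \<omega> \<Phi>) E = emeasure \<omega> (svm_preimage \<Phi> E)"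
  unfolding M_measure_def
proof (rule emeasure_measure_of_sigma)
  have \<Phi>': "\<Phi> \<in> set_maps \<omega>" using \<Phi> by (simp add: cont_maps_def)
  define S where "S = {x. \<not> is_singleton (\<Phi> x)}"
  have S: "S \<in> null_sets \<omega>" unfolding S_def by (rule null_not_singleton[OF \<omega> \<Phi>'])
  show "sigma_algebra UNIV (sets borel :: 'y set set)"
    by (metis sets.sigma_algebra_axioms space_borel)
  show "positive (sets borel) (\<lambda>E. emeasure \<omega> (svm_preimage \<Phi> E))"
    by (simp add: positive_def svm_preimage_def)
  show "countably_additive (sets borel) (\<lambda>E. emeasure \<omega> (svm_preimage \<Phi> E))"
  proof (rule countably_additiveI)
    fix A :: "nat \<Rightarrow> 'y set"
    assume A: "range A \<subseteq> sets borel" "disjoint_family A" "(\<Union>i. A i) \<in> sets borel"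
    have m: "svm_preimage \<Phi> (A i) \<in> sets \<omega>" for i
      using A(1) by (intro sets_svm_preimage[OF \<omega> \<Phi>]) auto
    have m': "svm_preimage \<Phi> (\<Union>i. A i) \<in> sets \<omega>"
      using A(3) by (intro sets_svm_preimage[OF \<omega> \<Phi>]) auto
    have disj: "disjoint_family (\<lambda>i. svm_preimage \<Phi> (A i) - S)"
      unfolding disjoint_family_on_def
    proof (intro ballI impI)
      fix i j :: nat assume "i \<noteq> j"
      then have "A i \<inter> A j = {}" using A(2) by (auto simp: disjoint_family_on_def)
      then show "(svm_preimage \<Phi> (A i) - S) \<inter> (svm_preimage \<Phi> (A j) - S) = {}"
        by (force simp: svm_preimage_def S_def is_singleton_def)
    qed
    have "(\<Sum>i. emeasure \<omega> (svm_preimage \<Phi> (A i))) =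
        (\<Sum>i. emeasure \<omega> (svm_preimage \<Phi> (A i) - S))"
      using emeasure_Diff_null_set[OF S m] by simp
    also have "\<dots> = emeasure \<omega> (\<Union>i. svm_preimage \<Phi> (A i) - S)"
      using m S disj by (intro suminf_emeasure) auto
    also have "(\<Union>i. svm_preimage \<Phi> (A i) - S) = svm_preimage \<Phi> (\<Union>i. A i) - S"
      by (auto simp: svm_preimage_def)
    also have "emeasure \<omega> \<dots> = emeasure \<omega> (svm_preimage \<Phi> (\<Union>i. A i))"
      by (rule emeasure_Diff_null_set[OF S m'])
    finally show "(\<Sum>i. emeasure \<omega> (svm_preimage \<Phi> (A i))) =
        emeasure \<omega> (svm_preimage \<Phi> (\<Union>i. A i))" .
  qed
qed (rule E)

lemma emeasure_weighted_diracs: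
  fixes p :: "'i \<Rightarrow> 'y::metric_space"
  assumes E: "E \<in> sets borel"
  shows "emeasure (weighted_diracs I g p) E =
    (\<Sum>i\<in>I. ennreal (g i) * emeasure (return borel (p i)) E)"
  unfolding weighted_diracs_def
proof (rule emeasure_measure_of_sigma)
  show "sigma_algebra UNIV (sets borel :: 'y set set)"
    by (metis sets.sigma_algebra_axioms space_borel)
  show "positive (sets borel) (\<lambda>E. \<Sum>i\<in>I. ennreal (g i) * emeasure (return borel (p i)) E)"
    by (simp add: positive_def)
  show "countably_additive (sets borel)
      (\<lambda>E. \<Sum>i\<in>I. ennreal (g i) * emeasure (return borel (p i)) E)"
  proof (rule countably_additiveI)
    fix A :: "nat \<Rightarrow> 'y set"
    assume A: "range A \<subseteq> sets borel" "disjoint_family A"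
    have "(\<Sum>j. \<Sum>i\<in>I. ennreal (g i) * emeasure (return borel (p i)) (A j)) =
        (\<Sum>i\<in>I. \<Sum>j. ennreal (g i) * emeasure (return borel (p i)) (A j))"
      by (rule suminf_sum) simp
    also have "\<dots> = (\<Sum>i\<in>I. ennreal (g i) * emeasure (return borel (p i)) (\<Union>j. A j))"
      using A by (simp add: suminf_emeasure del: emeasure_return)
    finally show "(\<Sum>j. \<Sum>i\<in>I. ennreal (g i) * emeasure (return borel (p i)) (A j)) =
        (\<Sum>i\<in>I. ennreal (g i) * emeasure (return borel (p i)) (\<Union>j. A j))" .
  qed
qed (rule E)

end

theory Submission
  imports Defs
begin

text \<open>
  Write \<open>f i\<close> for the function \<open>h (b i) (p i)\<close> and \<open>\<rho>\<close> for the minimum of the \<open>f i\<close>.  Let the cell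
  of \<open>j\<close> be the open set of points at which \<open>f j\<close> lies strictly below all other \<open>f i\<close>.  By (A2) and
  (A3)(a), \<open>T \<rho> x\<close> contains \<open>p i\<close> for every \<open>i\<close> that attains the minimum at \<open>x\<close>.  As \<open>T \<rho> x\<close> is a
  singleton for almost every \<open>x\<close> and the points \<open>p i\<close> are distinct, almost every \<open>x\<close> lies in the
  cell of some \<open>i\<close> and satisfies \<open>T \<rho> x = {p i}\<close>.  Hence \<open>M\<close> is the combination of the Dirac measures at the
  \<open>p i\<close> whose weights are the masses of the cells (\<open>M_measure_eq_cell_masses\<close>), and it remains to
  find parameters \<open>b\<close> for which these masses are the \<open>g i\<close>.

  The masses depend continuously on \<open>b\<close>, because strict inequalities persist under small changes
  and the cells exhaust almost all of \<open>X\<close> (\<open>measure_min_cell_tendsto\<close>).  Lowering \<open>b j\<close> lowers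
  \<open>f j\<close> alone, so it enlarges the cell of \<open>j\<close> and shrinks all other cells.  Keep \<open>b 1 = b0 1\<close> and
  consider the parameters \<open>b \<le> b0\<close> for which no cell \<open>i \<ge> 2\<close> exceeds its target \<open>g i\<close>.  Then
  cell 1 carries at least the mass \<open>g 1 > 0\<close>, which bounds every \<open>b i\<close> away from the left endpoint
  \<open>\<alpha> (p i)\<close>: close to it \<open>f i\<close> is uniformly below \<open>f 1\<close> and cell 1 is empty.  These parameters
  therefore form a nonempty compact set, on which the sum of the \<open>b i\<close> has a minimum.  At a minimum
  each of these targets is met exactly, since a cell below its target would allow its parameter to
  be lowered a little further (\<open>exists_exact_values\<close>).  Cell 1 then carries \<open>g 1\<close>, because the
  masses of all cells add up to \<open>\<omega>(X)\<close>, the sum of the \<open>g i\<close>.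
\<close>

section \<open>Cells of a minimum of finitely many functions\<close>

definition min_cell :: "'i set \<Rightarrow> ('i \<Rightarrow> 'x \<Rightarrow> real) \<Rightarrow> 'i \<Rightarrow> 'x set" where
  "min_cell I f j = {x. \<forall>i\<in>I - {j}. f j x < f i x}"

lemma min_cell_unique:
  "\<lbrakk>x \<in> min_cell I f i; x \<in> min_cell I f j; i \<in> I; j \<in> I\<rbrakk> \<Longrightarrow> i = j"
  using order_less_not_sym[of "f i x" "f j x"] unfolding min_cell_def
  by (cases "i = j") simp_all

lemma min_cell_mono:
  assumes "\<And>x. f' j x \<le> f j x" and "\<And>i x. i \<in> I - {j} \<Longrightarrow> f i x \<le> f' i x"
  shows "min_cell I f j \<subseteq> min_cell I f' j"
proof
  fix x assume x: "x \<in> min_cell I f j"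
  have "f' j x < f' i x" if "i \<in> I - {j}" for i
    using assms(1)[of x] assms(2)[OF that, of x] x that unfolding min_cell_def
    by (auto dest!: bspec[where x = i])
  then show "x \<in> min_cell I f' j" by (simp add: min_cell_def)
qed

lemma open_min_cell:
  fixes f :: "'i \<Rightarrow> 'x::metric_space \<Rightarrow> real"
  assumes "finite I" "j \<in> I" "\<And>i. i \<in> I \<Longrightarrow> continuous_on UNIV (f i)"
  shows "open (min_cell I f j)"
proof -
  have "min_cell I f j = (\<Inter>i\<in>I - {j}. {x. f j x < f i x})"
    unfolding min_cell_def by auto
  then show ?thesis
    using assms by (auto intro!: open_INT open_Collect_less)
qed

lemma radon_measure_finite:
  assumes "radon_measure \<omega>"
  shows "finite_measure \<omega>"
proof -
  obtain \<mu> where \<mu>: "finite_measure \<mu>" "\<omega> = completion \<mu>"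
    using assms unfolding radon_measure_def by blast
  interpret finite_measure \<mu> by fact
  show ?thesis
    using emeasure_finite by (intro finite_measureI) (simp add: \<mu>(2))
qed

lemma sets_min_cell:
  fixes f :: "'i \<Rightarrow> 'x::metric_space \<Rightarrow> real"
  assumes "radon_measure \<omega>" "finite I" "j \<in> I" "\<And>i. i \<in> I \<Longrightarrow> continuous_on UNIV (f i)"
  shows "min_cell I f j \<in> sets \<omega>"
proof -
  have "min_cell I f j \<in> sets borel"
    using open_min_cell[of I j f] assms(2-4) by (intro borel_open) blast
  then show ?thesis using sets_radon_measure[OF assms(1)] by (rule subsetD[rotated])
qed

text \<open>
  A point of the limiting cell \<open>i\<close> stays in cell \<open>i\<close> for all large \<open>k\<close>.  Since the limiting cells
  cover almost everything, the indicators of the cells converge almost everywhere, and the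
  finite measure allows dominated convergence.
\<close>

lemma measure_min_cell_tendsto:
  fixes f :: "'i \<Rightarrow> 'x::metric_space \<Rightarrow> real" and fs :: "nat \<Rightarrow> 'i \<Rightarrow> 'x \<Rightarrow> real"
  assumes \<omega>: "radon_measure \<omega>" and I: "finite I" "j \<in> I"
    and f: "\<And>i. i \<in> I \<Longrightarrow> continuous_on UNIV (f i)"
    and fs: "\<And>k i. i \<in> I \<Longrightarrow> continuous_on UNIV (fs k i)"
    and lim: "\<And>i x. i \<in> I \<Longrightarrow> (\<lambda>k. fs k i x) \<longlonglongrightarrow> f i x"
    and cover: "AE x in \<omega>. \<exists>i\<in>I. x \<in> min_cell I f i"
  shows "(\<lambda>k. measure \<omega> (min_cell I (fs k) j)) \<longlonglongrightarrow> measure \<omega> (min_cell I f j)"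
proof -
  interpret finite_measure \<omega> by (rule radon_measure_finite[OF \<omega>])
  have m: "min_cell I f j \<in> sets \<omega>" "min_cell I (fs k) j \<in> sets \<omega>" for k
    using sets_min_cell[OF \<omega> I] f fs by blast+
  have "(\<lambda>k. \<integral>x. indicator (min_cell I (fs k) j) x \<partial>\<omega>)
      \<longlonglongrightarrow> (\<integral>x. (indicator (min_cell I f j) x :: real) \<partial>\<omega>)"
  proof (rule integral_dominated_convergence[where w = "\<lambda>_. 1"])
    show "AE x in \<omega>. (\<lambda>k. indicator (min_cell I (fs k) j) x :: real)
        \<longlonglongrightarrow> indicator (min_cell I f j) x"
      using cover
    proof eventually_elim
      case (elim x)
      then obtain i where i: "i \<in> I" "x \<in> min_cell I f i" by blast
      have "\<forall>\<^sub>F k in sequentially. \<forall>l\<in>I - {i}. fs k i x < fs k l x"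
      proof (rule eventually_ball_finite)
        show "\<forall>l\<in>I - {i}. \<forall>\<^sub>F k in sequentially. fs k i x < fs k l x"
        proof
          fix l assume l: "l \<in> I - {i}"
          then have "f i x < f l x" using i by (simp add: min_cell_def)
          then obtain c where c: "f i x < c" "c < f l x" using dense by blast
          have "\<forall>\<^sub>F k in sequentially. fs k i x < c"
            using order_tendstoD(2)[OF lim[OF i(1)] c(1)] .
          moreover have "\<forall>\<^sub>F k in sequentially. c < fs k l x"
            using order_tendstoD(1)[OF lim c(2)] l by blast
          ultimately show "\<forall>\<^sub>F k in sequentially. fs k i x < fs k l x"
            by eventually_elim simp
        qed
      qed (use I in simp)
      then have "\<forall>\<^sub>F k in sequentially.
          (indicator (min_cell I (fs k) j) x :: real) = indicator (min_cell I f j) x"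
      proof eventually_elim
        case (elim k)
        then have "x \<in> min_cell I (fs k) i" by (simp add: min_cell_def)
        then have "x \<in> min_cell I (fs k) j \<longleftrightarrow> x \<in> min_cell I f j"
          using i I(2) min_cell_unique by metis
        then show ?case by (simp add: indicator_def)
      qed
      then show ?case by (rule tendsto_eventually)
    qed
  qed (use m in \<open>auto simp: indicator_def\<close>)
  then show ?thesis using m by simp
qed

section \<open>The measure of a minimum\<close>

lemma Min_image_mem:
  fixes f :: "'i \<Rightarrow> 'x \<Rightarrow> real"
  assumes "finite I" "I \<noteq> {}"
    and "\<And>f1 f2. f1 \<in> F \<Longrightarrow> f2 \<in> F \<Longrightarrow> (\<lambda>x. min (f1 x) (f2 x)) \<in> F"
    and "\<And>i. i \<in> I \<Longrightarrow> f i \<in> F"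
  shows "(\<lambda>x. MIN i\<in>I. f i x) \<in> F"
  using assms(1,2,4)
proof (induction I rule: finite_ne_induct)
  case (insert i I)
  then have "(\<lambda>x. min (f i x) (MIN i\<in>I. f i x)) \<in> F"
    by (intro assms(3)) auto
  with insert show ?case by simp
qed simp

text \<open>
  If \<open>f i\<close> attains the minimum \<open>\<rho>\<close> at \<open>x\<close>, then (A2) applied to \<open>f i\<close> and \<open>\<rho>\<close>, whose minimum is
  again \<open>\<rho>\<close>, carries the point \<open>p i\<close> from \<open>T (f i) x\<close> over to \<open>T \<rho> x\<close>.
\<close>

lemma minimizer_mem_T_Min:
  fixes f :: "'i \<Rightarrow> 'x::metric_space \<Rightarrow> real" and T :: "('x \<Rightarrow> real) \<Rightarrow> 'x \<Rightarrow> 'y::metric_space set"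
  assumes T: "T_concave \<omega> F T" and I: "finite I" "i \<in> I"
    and f: "\<And>i. i \<in> I \<Longrightarrow> f i \<in> F" and p: "p i \<in> T (f i) x"
    and least: "\<And>k. k \<in> I \<Longrightarrow> f i x \<le> f k x"
  shows "p i \<in> T (\<lambda>x. MIN i\<in>I. f i x) x"
proof -
  define \<rho> where "\<rho> = (\<lambda>x. MIN i\<in>I. f i x)"
  have \<rho>: "\<rho> \<in> F"
    unfolding \<rho>_def using T I f by (intro Min_image_mem) (auto simp: T_concave_def)
  have "f i x \<le> \<rho> x"
    unfolding \<rho>_def using I least by (intro Min.boundedI) auto
  then have "T (f i) x \<subseteq> T (\<lambda>x. min (f i x) (\<rho> x)) x"
    using T \<rho> f[OF I(2)] unfolding T_concave_def by blast
  moreover have "(\<lambda>x. min (f i x) (\<rho> x)) = \<rho>"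
    unfolding \<rho>_def using I by (auto simp: fun_eq_iff intro!: min_absorb2 Min_le)
  ultimately show ?thesis using p by (auto simp: \<rho>_def)
qed

text \<open>Two different minimizers at \<open>x\<close> would put two different points into the singleton \<open>T \<rho> x\<close>.\<close>

lemma AE_min_cell:
  fixes f :: "'i \<Rightarrow> 'x::metric_space \<Rightarrow> real" and T :: "('x \<Rightarrow> real) \<Rightarrow> 'x \<Rightarrow> 'y::metric_space set"
  assumes T: "T_concave \<omega> F T" and I: "finite I" "I \<noteq> {}"
    and f: "\<And>i. i \<in> I \<Longrightarrow> f i \<in> F" and p: "\<And>i x. i \<in> I \<Longrightarrow> p i \<in> T (f i) x"
    and inj: "inj_on p I"
  shows "AE x in \<omega>. \<exists>i\<in>I. x \<in> min_cell I f i \<and> T (\<lambda>x. MIN i\<in>I. f i x) x = {p i}"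
proof -
  define \<rho> where "\<rho> = (\<lambda>x. MIN i\<in>I. f i x)"
  have "\<rho> \<in> F"
    unfolding \<rho>_def using T I f by (intro Min_image_mem) (auto simp: T_concave_def)
  then have "T \<rho> \<in> set_maps \<omega>"
    using T unfolding T_concave_def cont_surj_maps_def cont_maps_def by blast
  then have "AE x in \<omega>. is_singleton (T \<rho> x)" by (simp add: set_maps_def)
  then show ?thesis
  proof eventually_elim
    case (elim x)
    then obtain q where q: "T \<rho> x = {q}" by (auto simp: is_singleton_def)
    have mem: "p k = q" if "k \<in> I" "\<And>l. l \<in> I \<Longrightarrow> f k x \<le> f l x" for k
      using minimizer_mem_T_Min[of \<omega> F T I k f p x] T I f p that q \<rho>_def by auto
    obtain i where i: "i \<in> I" "\<And>l. l \<in> I \<Longrightarrow> f i x \<le> f l x"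
      using I ex_is_arg_min_if_finite[of I "\<lambda>i. f i x"]
      by (auto simp: is_arg_min_linorder)
    have "f i x < f k x" if k: "k \<in> I - {i}" for k
    proof (rule ccontr)
      assume "\<not> f i x < f k x"
      then have "p k = q" using k i by (intro mem) force+
      then show False using mem[OF i] inj i(1) k by (auto dest: inj_onD)
    qed
    then have "x \<in> min_cell I f i" by (simp add: min_cell_def)
    moreover have "T \<rho> x = {p i}" using q mem[OF i] by simp
    ultimately show ?case using i(1) by (auto simp: \<rho>_def)
  qed
qed

lemma M_measure_eq_cell_masses:
  fixes f :: "'i \<Rightarrow> 'x::metric_space \<Rightarrow> real" and T :: "('x \<Rightarrow> real) \<Rightarrow> 'x \<Rightarrow> 'y::metric_space set"
  assumes \<omega>: "radon_measure \<omega>" and T: "T_concave \<omega> F T" and I: "finite I" "I \<noteq> {}"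
    and f: "\<And>i. i \<in> I \<Longrightarrow> f i \<in> F" and p: "\<And>i x. i \<in> I \<Longrightarrow> p i \<in> T (f i) x"
    and inj: "inj_on p I"
  shows "M_measure \<omega> (T (\<lambda>x. MIN i\<in>I. f i x)) =
    weighted_diracs I (\<lambda>i. measure \<omega> (min_cell I f i)) p"
proof (rule measure_eqI)
  define \<rho> where "\<rho> = (\<lambda>x. MIN i\<in>I. f i x)"
  have "\<rho> \<in> F"
    unfolding \<rho>_def using T I f by (intro Min_image_mem) (auto simp: T_concave_def)
  then have \<Phi>: "T \<rho> \<in> cont_maps \<omega>"
    using T unfolding T_concave_def cont_surj_maps_def by blast
  have cell: "min_cell I f i \<in> sets \<omega>" if "i \<in> I" for i
    using T f that by (intro sets_min_cell[OF \<omega> I(1)]) (auto simp: T_concave_def pos_cont_def)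
  interpret finite_measure \<omega> by (rule radon_measure_finite[OF \<omega>])
  fix E assume "E \<in> sets (M_measure \<omega> (T (\<lambda>x. MIN i\<in>I. f i x)))"
  then have E: "E \<in> sets borel" by simp
  define J where "J = {i\<in>I. p i \<in> E}"
  have ae: "AE x in \<omega>. \<exists>i\<in>I. x \<in> min_cell I f i \<and> T (\<lambda>x. MIN i\<in>I. f i x) x = {p i}"
    by (rule AE_min_cell[of \<omega> F T I f p]) (use T I f p inj in auto)
  have "emeasure (M_measure \<omega> (T \<rho>)) E = emeasure \<omega> (svm_preimage (T \<rho>) E)"
    by (rule emeasure_M_measure[OF \<omega> \<Phi> E])
  also have "\<dots> = emeasure \<omega> (\<Union>i\<in>J. min_cell I f i)"
  proof (rule emeasure_eq_AE)
    show "AE x in \<omega>. x \<in> svm_preimage (T \<rho>) E \<longleftrightarrow> x \<in> (\<Union>i\<in>J. min_cell I f i)"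
      unfolding \<rho>_def using ae
    proof eventually_elim
      case (elim x)
      then obtain i where i: "i \<in> I" "x \<in> min_cell I f i" "T (\<lambda>x. MIN i\<in>I. f i x) x = {p i}"
        by blast
      have "x \<in> svm_preimage (T \<rho>) E \<longleftrightarrow> p i \<in> E"
        using i(3) by (simp add: svm_preimage_def \<rho>_def)
      moreover have "x \<in> (\<Union>i\<in>J. min_cell I f i) \<longleftrightarrow> i \<in> J"
      proof
        assume "x \<in> (\<Union>i\<in>J. min_cell I f i)"
        then obtain k where k: "k \<in> J" "x \<in> min_cell I f k" by blast
        then have "i = k" using min_cell_unique[OF i(2) k(2) i(1)] by (simp add: J_def)
        then show "i \<in> J" using k(1) by simp
      qed (use i in blast)
      ultimately show ?case using i(1) by (simp add: J_def \<rho>_def)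
    qed
  qed (use sets_svm_preimage[OF \<omega> \<Phi> E] cell I in \<open>auto simp: J_def\<close>)
  also have "\<dots> = (\<Sum>i\<in>J. emeasure \<omega> (min_cell I f i))"
    using I(1) cell
    by (intro sum_emeasure[symmetric])
      (auto simp: J_def disjoint_family_on_def dest: min_cell_unique)
  also have "\<dots> = (\<Sum>i\<in>I. ennreal (measure \<omega> (min_cell I f i)) * emeasure (return borel (p i)) E)"
    using I(1) E unfolding J_def
    by (simp add: sum.inter_filter emeasure_eq_measure)
  also have "\<dots> = emeasure (weighted_diracs I (\<lambda>i. measure \<omega> (min_cell I f i)) p) E"
    by (rule emeasure_weighted_diracs[OF E, symmetric])
  finally show "emeasure (M_measure \<omega> (T (\<lambda>x. MIN i\<in>I. f i x))) E =
      emeasure (weighted_diracs I (\<lambda>i. measure \<omega> (min_cell I f i)) p) E"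
    by (simp add: \<rho>_def)
qed simp

lemma sum_measure_min_cell:
  fixes f :: "'i \<Rightarrow> 'x::metric_space \<Rightarrow> real"
  assumes \<omega>: "radon_measure \<omega>" and I: "finite I"
    and f: "\<And>i. i \<in> I \<Longrightarrow> continuous_on UNIV (f i)"
    and cover: "AE x in \<omega>. \<exists>i\<in>I. x \<in> min_cell I f i"
  shows "(\<Sum>i\<in>I. measure \<omega> (min_cell I f i)) = measure \<omega> UNIV"
proof -
  interpret finite_measure \<omega> by (rule radon_measure_finite[OF \<omega>])
  have cell: "min_cell I f i \<in> sets \<omega>" if "i \<in> I" for i
    using sets_min_cell[OF \<omega> I that f] .
  have "(\<Sum>i\<in>I. measure \<omega> (min_cell I f i)) = measure \<omega> (\<Union>i\<in>I. min_cell I f i)"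
    using I cell
    by (intro finite_measure_finite_Union[symmetric])
      (auto simp: disjoint_family_on_def dest: min_cell_unique)
  also have "\<dots> = measure \<omega> (space \<omega>)"
    using cover I cell by (intro measure_eq_AE) auto
  finally show ?thesis using space_radon_measure[OF \<omega>] by simp
qed

lemma measure_weighted_diracs_atom:
  fixes p :: "'i \<Rightarrow> 'y::metric_space"
  assumes I: "finite I" "j \<in> I" and inj: "inj_on p I" and g: "g j \<ge> 0"
  shows "measure (weighted_diracs I g p) {p j} = g j"
proof -
  have "emeasure (weighted_diracs I g p) {p j} =
      (\<Sum>i\<in>I. ennreal (g i) * emeasure (return borel (p i)) {p j})"
    by (rule emeasure_weighted_diracs) simp
  also have "\<dots> = (\<Sum>i\<in>I. if i = j then ennreal (g j) else 0)"
    using I(2) inj by (intro sum.cong) (auto simp: indicator_def dest: inj_onD)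
  also have "\<dots> = ennreal (g j)" using I by simp
  finally show ?thesis using g by (simp add: measure_def)
qed

section \<open>Meeting all targets by minimizing the sum of the parameters\<close>

text \<open>
  The values \<open>m b i\<close> stand for quantities that compete: by \<open>mono\<close>, lowering \<open>b j\<close> can only decrease
  \<open>m b i\<close> for \<open>i \<noteq> j\<close>.  By \<open>interior\<close>, no \<open>b j\<close> with \<open>j \<in> J\<close> reaches its lower bound as long as no
  target is exceeded, so a minimizer of the sum can still be moved downwards in each
  coordinate of \<open>J\<close>.
\<close>

lemma exists_exact_values:
  fixes a c :: "'i \<Rightarrow> real" and m :: "('i \<Rightarrow> real) \<Rightarrow> 'i \<Rightarrow> real"
  defines "B \<equiv> (\<Pi> i\<in>UNIV. {a i..c i})"
  assumes J: "finite J" and start: "b0 \<in> B" "\<And>i. i \<in> J \<Longrightarrow> m b0 i \<le> g i"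
    and cont: "\<And>i. i \<in> J \<Longrightarrow> continuous_on B (\<lambda>b. m b i)"
    and mono: "\<And>b i j t. \<lbrakk>b \<in> B; i \<in> J; j \<in> J; i \<noteq> j; a j \<le> t; t \<le> b j\<rbrakk>
      \<Longrightarrow> m (b(j := t)) i \<le> m b i"
    and interior: "\<And>b j. \<lbrakk>b \<in> B; \<And>i. i \<in> J \<Longrightarrow> m b i \<le> g i; j \<in> J\<rbrakk> \<Longrightarrow> a j < b j"
  obtains b where "b \<in> B" "\<And>i. i \<in> J \<Longrightarrow> m b i = g i"
proof -
  define V where "V i = {b\<in>B. m b i \<le> g i}" for i
  define W where "W = \<Inter>(insert B (V ` J))"
  have "compactin (product_topology (\<lambda>_. euclidean) UNIV) (\<Pi>\<^sub>E i\<in>UNIV. {a i..c i})"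
    by (simp add: compactin_PiE)
  then have B: "compact B"
    by (simp add: B_def euclidean_product_topology PiE_UNIV_domain)
  have V: "closedin (top_of_set B) (V i)" if "i \<in> J" for i
  proof -
    have "closedin (top_of_set B) (B \<inter> (\<lambda>b. m b i) -` {..g i})"
      by (rule continuous_closedin_preimage[OF cont[OF that]]) simp
    moreover have "B \<inter> (\<lambda>b. m b i) -` {..g i} = V i" by (auto simp: V_def)
    ultimately show ?thesis by metis
  qed
  have "closedin (top_of_set B) W"
    unfolding W_def using V by (intro closedin_Inter) auto
  then have "compact W" using B by (rule closedin_compact[rotated])
  moreover have "W \<noteq> {}" using start by (auto simp: W_def V_def)
  moreover have "continuous_on W (\<lambda>b. \<Sum>i\<in>J. b i)"
    by (intro continuous_on_sum) (rule continuous_on_product_then_coordinatewise, simp)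
  ultimately obtain b where b: "b \<in> W" and least: "\<And>b'. b' \<in> W \<Longrightarrow> (\<Sum>i\<in>J. b i) \<le> (\<Sum>i\<in>J. b' i)"
    using continuous_attains_inf by metis
  have bB: "b \<in> B" and bg: "\<And>i. i \<in> J \<Longrightarrow> m b i \<le> g i" using b by (auto simp: W_def V_def)
  have "m b j = g j" if j: "j \<in> J" for j
  proof (rule ccontr)
    assume "m b j \<noteq> g j"
    with bg[OF j] have less: "m b j < g j" by simp
    have low: "a j < b j" using interior[OF bB bg j] .
    have in_B: "b(j := t) \<in> B" if "t \<in> {a j..b j}" for t
      using bB that by (auto simp: B_def Pi_iff) (meson order_trans)
    have "continuous_on {a j..b j} (\<lambda>t. m (b(j := t)) j)"
    proof (rule continuous_on_compose2[OF cont[OF j]])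
      show "continuous_on {a j..b j} (\<lambda>t. b(j := t))"
      proof (rule continuous_on_coordinatewise_then_product)
        show "continuous_on {a j..b j} (\<lambda>t. (b(j := t)) i)" for i
          by (cases "i = j") simp_all
      qed
    qed (use in_B in auto)
    then have "((\<lambda>t. m (b(j := t)) j) \<longlongrightarrow> m b j) (at (b j) within {a j..b j})"
      using low by (auto simp: continuous_on_def dest: bspec[where x = "b j"])
    then have "((\<lambda>t. m (b(j := t)) j) \<longlongrightarrow> m b j) (at_left (b j))"
      using low by (simp add: at_within_Icc_at_left)
    then have "\<forall>\<^sub>F t in at_left (b j). m (b(j := t)) j < g j"
      using less by (rule order_tendstoD(2))
    moreover have "\<forall>\<^sub>F t in at_left (b j). a j < t \<and> t < b j"
      using low eventually_at_left_field by blast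
    ultimately have "\<forall>\<^sub>F t in at_left (b j). m (b(j := t)) j < g j \<and> a j < t \<and> t < b j"
      by eventually_elim simp
    then obtain t where t: "m (b(j := t)) j < g j" "a j < t" "t < b j"
      using eventually_happens'[OF trivial_limit_at_left_real] by blast
    have "m (b(j := t)) i \<le> g i" if i: "i \<in> J" for i
    proof (cases "i = j")
      case False
      then show ?thesis using mono[OF bB i j False, of t] bg[OF i] t by simp
    qed (use t in simp)
    then have "b(j := t) \<in> W" using in_B[of t] t by (auto simp: W_def V_def)
    then have "(\<Sum>i\<in>J. b i) \<le> (\<Sum>i\<in>J. (b(j := t)) i)" by (rule least)
    also have "\<dots> < (\<Sum>i\<in>J. b i)"
      using J j t(3) by (intro sum_strict_mono_ex1) auto
    finally show False by simp
  qed
  then show thesis using that bB by blast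
qed

section \<open>The one-parameter families\<close>

lemma continuous_on_of_Sup_diff:
  fixes u :: "real \<Rightarrow> 'x::metric_space \<Rightarrow> real"
  assumes X: "compact (UNIV :: 'x set)" and S: "open S"
    and u: "\<And>t. t \<in> S \<Longrightarrow> continuous_on UNIV (u t)"
    and lim: "\<And>t. t \<in> S \<Longrightarrow> ((\<lambda>t'. SUP x. \<bar>u t' x - u t x\<bar>) \<longlongrightarrow> 0) (at t)"
  shows "continuous_on S (\<lambda>t. u t x)"
proof -
  have "((\<lambda>t'. u t' x) \<longlongrightarrow> u t x) (at t)" if t: "t \<in> S" for t
  proof -
    have "\<forall>\<^sub>F t' in at t. t' \<in> S" using S t by (rule eventually_at_in_open')
    then have "\<forall>\<^sub>F t' in at t. norm (u t' x - u t x) \<le> (SUP x. \<bar>u t' x - u t x\<bar>)"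
    proof eventually_elim
      case (elim t')
      have "compact (range (\<lambda>x. \<bar>u t' x - u t x\<bar>))"
        by (intro compact_continuous_image continuous_intros u elim t X)
      then have "bdd_above (range (\<lambda>x. \<bar>u t' x - u t x\<bar>))"
        by (intro bounded_imp_bdd_above compact_imp_bounded)
      then show ?case by (auto intro: cSUP_upper)
    qed
    then have "((\<lambda>t'. u t' x - u t x) \<longlongrightarrow> 0) (at t)"
      using lim[OF t] by (rule Lim_null_comparison)
    then show ?thesis by (simp add: LIM_zero_iff)
  qed
  then show ?thesis by (auto simp: continuous_on_eq_continuous_at S isCont_def)
qed

lemma einterval_exists_close_to_left:
  assumes "\<alpha> < \<beta>" and "eventually P (filtercomap ereal (at_right \<alpha>))"
  obtains t where "t \<in> einterval \<alpha> \<beta>" "P t"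
proof -
  obtain Q where Q: "eventually Q (at_right \<alpha>)" "\<And>t. Q (ereal t) \<Longrightarrow> P t"
    using assms(2) by (auto simp: eventually_filtercomap)
  obtain \<gamma> where \<gamma>: "\<alpha> < \<gamma>" "\<And>y. \<alpha> < y \<Longrightarrow> y < \<gamma> \<Longrightarrow> Q y"
    using Q(1) eventually_at_right[OF assms(1)] by blast
  obtain t where "\<alpha> < ereal t" "ereal t < min \<gamma> \<beta>"
    using ereal_dense2[of \<alpha> "min \<gamma> \<beta>"] assms(1) \<gamma>(1) by auto
  then show thesis using that[of t] Q(2) \<gamma>(2) by (simp add: einterval_iff)
qed

text \<open>
  A positive continuous function on the compact space \<open>X\<close> has a positive lower bound, so (A3)(c)
  pushes the family below it.
\<close>

lemma A3_exists_below:
  fixes h :: "real \<Rightarrow> 'y::metric_space \<Rightarrow> 'x::metric_space \<Rightarrow> real"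
  assumes X: "compact (UNIV :: 'x set)" and A3: "property_A3 F T \<alpha> \<beta> h" and f: "f \<in> pos_cont"
  obtains t where "t \<in> einterval (\<alpha> y) (\<beta> y)" "\<And>x. h t y x < f x"
proof -
  obtain z where z: "\<And>x. f z \<le> f x"
    using continuous_attains_inf[OF X, of f] f by (auto simp: pos_cont_def)
  have "f z > 0" using f by (simp add: pos_cont_def)
  then have "\<forall>\<^sub>F t in filtercomap ereal (at_right (\<alpha> y)). \<forall>x\<in>UNIV. dist (h t y x) 0 < f z"
    using A3 unfolding property_A3_def uniform_limit_iff by blast
  moreover have "\<alpha> y < \<beta> y" using A3 by (simp add: property_A3_def)
  ultimately obtain t where "t \<in> einterval (\<alpha> y) (\<beta> y)" "\<forall>x\<in>UNIV. dist (h t y x) 0 < f z"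
    using einterval_exists_close_to_left by blast
  moreover have "h t y x < f x" if "dist (h t y x) 0 < f z" for t x
    using that z[of x] by (simp add: dist_real_def)
  ultimately show thesis using that by blast
qed

section \<open>Prescribing the point masses\<close>

theorem theorem2p5:
  fixes \<omega> :: "'x::metric_space measure"
    and p :: "nat \<Rightarrow> 'y::metric_space"
    and g :: "nat \<Rightarrow> real"
    and N :: nat
    and F :: "('x \<Rightarrow> real) set"
    and T :: "('x \<Rightarrow> real) \<Rightarrow> 'x \<Rightarrow> 'y set"
    and \<alpha> \<beta> :: "'y \<Rightarrow> ereal"
    and h :: "real \<Rightarrow> 'y \<Rightarrow> 'x \<Rightarrow> real"
    and b0 :: "nat \<Rightarrow> real"
  assumes compact_X: "compact (UNIV :: 'x set)"
    and compact_Y: "compact (UNIV :: 'y set)"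
    and radon: "radon_measure \<omega>"
    and N: "N \<ge> 2"
    and p_distinct: "inj_on p {1..N}"
    and g_pos: "\<And>i. i \<in> {1..N} \<Longrightarrow> g i > 0"
    and concave: "T_concave \<omega> F T"
    and A3: "property_A3 F T \<alpha> \<beta> h"
    and mass: "measure \<omega> UNIV = (\<Sum>i=1..N. g i)"
    and b0: "\<And>i. i \<in> {1..N} \<Longrightarrow> b0 i \<in> einterval (\<alpha> (p i)) (\<beta> (p i))"
    and rho0: "\<And>i. i \<in> {2..N} \<Longrightarrow>
      measure (M_measure \<omega> (T (\<lambda>x. MIN j\<in>{1..N}. h (b0 j) (p j) x))) {p i} \<le> g i"
  shows "\<exists>b :: nat \<Rightarrow> real.
    (\<forall>i\<in>{2..N}. b i \<in> einterval (\<alpha> (p i)) (\<beta> (p i))) \<and>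
    b 1 = b0 1 \<and>
    M_measure \<omega> (T (\<lambda>x. MIN i\<in>{1..N}. h (b i) (p i) x)) = weighted_diracs {1..N} g p"
proof -
  define I where "I = {1..N}"
  define J where "J = {2..N}"
  define D where "D i = einterval (\<alpha> (p i)) (\<beta> (p i))" for i
  define f where "f b i = h (b i) (p i)" for b :: "nat \<Rightarrow> real" and i
  define m where "m b i = measure \<omega> (min_cell I (f b) i)" for b i
  have I: "finite I" "I \<noteq> {}" "1 \<in> I" "1 \<notin> J" "J \<subseteq> I" "finite J"
    using N by (auto simp: I_def J_def)
  have I_eq: "I = insert 1 J"
    using N by (auto simp: I_def J_def)
  have F_cont: "continuous_on UNIV u" if "u \<in> F" for u
    using concave that by (auto simp: T_concave_def pos_cont_def)
  have hF: "h t (p i) \<in> F" if "t \<in> D i" for t i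
    using A3 that by (simp add: property_A3_def D_def)
  have h_mono: "h s (p i) x \<le> h t (p i) x" if "s \<in> D i" "t \<in> D i" "s \<le> t" for s t i x
    using A3 that by (simp add: property_A3_def D_def)
  have h_cont: "continuous_on (D i) (\<lambda>t. h t (p i) x)" for i x
    using A3 by (intro continuous_on_of_Sup_diff compact_X F_cont hF)
      (auto simp: property_A3_def D_def)
  have fF: "f b i \<in> F" if "b i \<in> D i" for b i
    using hF that by (simp add: f_def)
  have pT: "p i \<in> T (f b i) x" if "b i \<in> D i" for b i x
    using A3 that by (simp add: property_A3_def D_def f_def)
  have inj: "inj_on p I" using p_distinct by (simp add: I_def)
  have b0D: "b0 i \<in> D i" if "i \<in> I" for i using b0 that by (simp add: I_def D_def)

  have M: "M_measure \<omega> (T (\<lambda>x. MIN i\<in>I. h (b i) (p i) x)) = weighted_diracs I (m b) p"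
    if "\<And>i. i \<in> I \<Longrightarrow> b i \<in> D i" for b
    using M_measure_eq_cell_masses[of \<omega> F T I "f b" p] radon concave I fF pT inj that
    by (auto simp: m_def[abs_def] f_def)
  have cover: "AE x in \<omega>. \<exists>i\<in>I. x \<in> min_cell I (f b) i" if "\<And>i. i \<in> I \<Longrightarrow> b i \<in> D i" for b
  proof -
    have "AE x in \<omega>. \<exists>i\<in>I. x \<in> min_cell I (f b) i \<and> T (\<lambda>x. MIN i\<in>I. f b i x) x = {p i}"
      using AE_min_cell[of \<omega> F T I "f b" p] concave I fF pT inj that by blast
    then show ?thesis by eventually_elim blast
  qed
  have total: "m b 1 + (\<Sum>i\<in>J. m b i) = g 1 + (\<Sum>i\<in>J. g i)" if "\<And>i. i \<in> I \<Longrightarrow> b i \<in> D i" for b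
  proof -
    have "(\<Sum>i\<in>I. m b i) = measure \<omega> UNIV"
      unfolding m_def using sum_measure_min_cell[OF radon I(1) _ cover] F_cont fF that by blast
    then show ?thesis using mass I unfolding I_def[symmetric] by (simp add: I_eq)
  qed

  \<comment> \<open>A parameter at which \<open>f i\<close> is below \<open>f 1\<close> everywhere empties cell 1, so it can serve as a
    lower bound that is never reached.\<close>
  have "\<exists>a. a \<in> D i \<and> a \<le> b0 i \<and> (\<forall>x. h a (p i) x < f b0 1 x)" if i: "i \<in> I" for i
  proof -
    have "f b0 1 \<in> pos_cont"
      using fF[of b0 1] b0D[OF I(3)] concave by (auto simp: T_concave_def)
    then obtain t where t: "t \<in> D i" "\<And>x. h t (p i) x < f b0 1 x"
      using A3_exists_below[OF compact_X A3] unfolding D_def by metis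
    have min_D: "min t (b0 i) \<in> D i" using t(1) b0D[OF i] by (simp add: min_def)
    have "h (min t (b0 i)) (p i) x < f b0 1 x" for x
      using h_mono[OF min_D t(1)] t(2)[of x] by (meson le_less_trans min.cobounded1)
    then show ?thesis using min_D by auto
  qed
  then obtain l where l: "\<And>i. i \<in> I \<Longrightarrow> l i \<in> D i" "\<And>i. i \<in> I \<Longrightarrow> l i \<le> b0 i"
    "\<And>i x. i \<in> I \<Longrightarrow> h (l i) (p i) x < f b0 1 x"
    by metis
  \<comment> \<open>All coordinates outside \<open>J\<close>, in particular the first, are held at their values in \<open>b0\<close>.\<close>
  define a where "a i = (if i \<in> J then l i else b0 i)" for i
  define B where "B = (\<Pi> i\<in>UNIV. {a i..b0 i})"
  have B_D: "b i \<in> D i" if b: "b \<in> B" and i: "i \<in> I" for b i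
  proof -
    have "a i \<in> D i" using l i b0D by (auto simp: a_def)
    moreover have "a i \<le> b i" "b i \<le> b0 i" using b by (auto simp: B_def)
    ultimately show ?thesis using b0D[OF i] unfolding D_def einterval_iff
      by (metis ereal_less_eq(3) le_less_trans less_le_trans)
  qed
  have B_1: "b 1 = b0 1" if "b \<in> B" for b
  proof -
    have "b 1 \<in> {a 1..b0 1}" using that unfolding B_def by blast
    then show ?thesis using I(4) by (simp add: a_def)
  qed

  obtain b where b: "b \<in> B" "\<And>i. i \<in> J \<Longrightarrow> m b i = g i"
  proof (rule exists_exact_values[of J b0 a b0 m g, folded B_def])
    show "finite J" by (rule I)
    show "b0 \<in> B" using l(2) I(5) by (auto simp: B_def a_def dest: subsetD)
    show "m b0 i \<le> g i" if i: "i \<in> J" for i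
    proof -
      have "measure (weighted_diracs I (m b0) p) {p i} = m b0 i"
        using I i inj by (intro measure_weighted_diracs_atom) (auto simp: m_def)
      then show ?thesis using rho0[of i] M[of b0] b0D i by (simp add: I_def J_def)
    qed
    show "continuous_on B (\<lambda>b. m b i)" if i: "i \<in> J" for i
    proof (rule continuous_on_sequentiallyI)
      fix bs b assume bs: "\<forall>k. bs k \<in> B" and b: "b \<in> B" and lim: "bs \<longlonglongrightarrow> b"
      have "(\<lambda>k. f (bs k) j x) \<longlonglongrightarrow> f b j x" if j: "j \<in> I" for j x
      proof -
        have "isCont (\<lambda>b. b j) b"
          by (rule continuous_on_eq_continuous_at[OF open_UNIV, THEN iffD1, rule_format])
            (rule continuous_on_product_coordinates, rule UNIV_I)
        then have "(\<lambda>k. bs k j) \<longlonglongrightarrow> b j" using lim by (rule isCont_tendsto_compose)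
        then show ?thesis unfolding f_def
          using bs b B_D j by (intro continuous_on_tendsto_compose[OF h_cont]) auto
      qed
      then show "(\<lambda>k. m (bs k) i) \<longlonglongrightarrow> m b i"
        unfolding m_def using I i bs b B_D fF F_cont
        by (intro measure_min_cell_tendsto radon cover) auto
    qed
    show "m (b(j := t)) i \<le> m b i"
      if b: "b \<in> B" and ij: "i \<in> J" "j \<in> J" "i \<noteq> j" and t: "a j \<le> t" "t \<le> b j" for b i j t
    proof -
      interpret finite_measure \<omega> by (rule radon_measure_finite[OF radon])
      have "b(j := t) \<in> B"
        using b t by (auto simp: B_def Pi_iff) (meson order_trans)
      then have "t \<in> D j" using B_D[of "b(j := t)" j] ij I by auto
      then have "f (b(j := t)) k x \<le> f b k x" if "k \<in> I" for k x
        using h_mono[of t j "b j"] B_D[OF b that] t by (auto simp: f_def)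
      then have "min_cell I (f (b(j := t))) i \<subseteq> min_cell I (f b) i"
        using ij by (intro min_cell_mono) (auto simp: f_def)
      then show ?thesis unfolding m_def
        using I ij B_D[OF b] fF F_cont by (intro finite_measure_mono sets_min_cell radon) auto
    qed
    show "a j < b j" if b: "b \<in> B" and le: "\<And>i. i \<in> J \<Longrightarrow> m b i \<le> g i" and j: "j \<in> J" for b j
    proof (rule ccontr)
      assume "\<not> a j < b j"
      moreover have "b j \<in> {a j..b0 j}" using b unfolding B_def by blast
      ultimately have "b j = l j" using j by (simp add: a_def)
      then have "f b j x < f b 1 x" for x
        using l(3)[of j x] j I B_1[OF b] by (auto simp: f_def)
      then have "\<not> f b 1 x < f b j x" for x by (rule order_less_not_sym)
      moreover have "j \<in> I - {1}" using j I(4,5) by blast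
      ultimately have "min_cell I (f b) 1 = {}" unfolding min_cell_def by blast
      then have "m b 1 = 0" by (simp add: m_def)
      moreover have "(\<Sum>i\<in>J. m b i) \<le> (\<Sum>i\<in>J. g i)" using le by (rule sum_mono)
      moreover have "g 1 > 0" using g_pos I by (simp add: I_def)
      ultimately show False using total[of b] B_D[OF b] by fastforce
    qed
  qed (use that in blast)
  have "m b 1 = g 1" using total[of b] b B_D by simp
  then have m_g: "m b i = g i" if "i \<in> I" for i using b(2) that I_eq by auto
  have "M_measure \<omega> (T (\<lambda>x. MIN i\<in>I. h (b i) (p i) x)) = weighted_diracs I (m b) p"
    using M B_D b(1) by blast
  also have "\<dots> = weighted_diracs I g p"
    using m_g by (simp add: weighted_diracs_def cong: sum.cong)
  finally have "M_measure \<omega> (T (\<lambda>x. MIN i\<in>I. h (b i) (p i) x)) = weighted_diracs I g p" .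
  moreover have "\<forall>i\<in>J. b i \<in> D i" using B_D b(1) I by blast
  ultimately show ?thesis
    using B_1[OF b(1)] unfolding I_def J_def D_def by blast
qed

end
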